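(* Let $\mathsf n\ge 1$ and $\mathsf f\ge2$ be integers, let $(\mathfrak A,\mathfrak B)$ be an access structure on $[\mathsf n]$ with $\mathfrak A\ne\emptyset$, and let $\Phi$ be a linear $(\mathfrak A,\mathfrak B,\mathsf n,\mathsf f)$-CSSPIR protocol over a finite field $\mathbb F_q$ with PIR rate $R_{\mathrm{PIR}}$, shared randomness rate $\rho$ and position map $\tau$; let $\mathcal M=\mathbb F_q^{\mathsf x}$ be its file space, $\mathbb F_q^{\mathsf y}$ its seed space, and let $0$ denote a fixed element of its set $\mathcal R$ of user randomness values. Define an NSS protocol $\hat\Phi$ as follows: the secret is $L\in\mathbb F_q^{\mathsf x}$, the dealer's randomness is $U_{\mathrm{NSS}}$ uniform on $\mathbb F_q^{\mathsf y}$, and the $j$-th share $S_j$ ($j\in[\mathsf n]$) is the answer $D_j$ of server $j$ in $\Phi$ when $K=1$, $R=0$, $M_1=L$, $M_2=\cdots=M_{\mathsf f}=0$ and the random seed equals $U_{\mathrm{NSS}}$. Then $\hat\Phi$ is a linear $(\mathfrak A,\mathfrak B,\mathsf n)$-CSNSS protocol with SS rate $R_{\mathrm{PIR}}$, randomness rate $\rho$ and position map $\tau$.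
   Context: Notation: $[n]=\{1,\dots,n\}$. For a tuple $A=(A_1,\dots,A_n)$ and $\mathcal X\subset[n]$, $A_{\mathcal X}=(A_i)_{i\in\mathcal X}$; for a matrix $\mathsf A$ with rows indexed by $[n]$, $\mathsf A_{\mathcal X}$ is the submatrix of rows indexed by $\mathcal X$. $I(\cdot;\cdot)$ is mutual information. Access structure on $[\mathsf n]$: a pair $(\mathfrak A,\mathfrak B)$ of subsets of $2^{[\mathsf n]}$ with $\mathfrak A$ closed under supersets, $\mathfrak B$ closed under subsets, and $\mathfrak A\cap\mathfrak B=\emptyset$. SPIR protocol ($\mathsf n$ servers, $\mathsf f$ files). Data: finite sets $\mathcal M$ (files), $\mathcal U$ (random seeds), $\mathcal R$ (user randomness), $\mathcal T_j,\mathcal Q_j,\mathcal D_j$ ($j\in[\mathsf n]$), and deterministic maps $h:\mathcal U\to\prod_j\mathcal T_j$, $\phi:[\mathsf f]\times\mathcal R\to\prod_j\mathcal Q_j$, $g_j:\mathcal Q_j\times\mathcal M^{\mathsf f}\times\mathcal T_j\to\mathcal D_j$. The random variables $M=(M_1,\dots,M_{\mathsf f})\in\mathcal M^{\mathsf f}$, $U\in\mathcal U$, $K\in[\mathsf f]$, $R\in\mathcal R$ are uniform and mutually independent; $T=h(U)$, $Q=\phi(K,R)$, $D_j=g_j(Q_j,M,T_j)$, $D=(D_1,\dots,D_{\mathsf n})$. It is an $(\mathfrak A,\mathfrak B,\mathsf n,\mathsf f)$-CSSPIR protocol (completely secure SPIR) if: - Correctness: for all $r\in\mathcal R$, $k\in[\mathsf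 f]$, $\mathcal A\in\mathfrak A$, given $K=k,R=r$ the maximum likelihood decoder of $M_k$ from $D_{\mathcal A}$ has error probability $0$ (i.e. $M_k$ is a function of $D_{\mathcal A}$). - Server secrecy: $I(D;M_{[\mathsf f]\setminus\{k\}}\mid R=r,K=k)=0$ for all $r,k$. - User secrecy: $I(K;Q_{\mathcal B})=0$ for all $\mathcal B\in\mathfrak B$. The PIR rate is $\log|\mathcal M|/\sum_j\log|\mathcal D_j|$; the shared randomness rate is $\log|\mathcal U|/\log|\mathcal M|$. Linear SPIR over $\mathbb F_q$ with position map $\tau:[\mathsf z]\to[\mathsf n]$: a SPIR protocol in which $\mathcal M=\mathbb F_q^{\mathsf x}$, $M\in\mathbb F_q^{\mathsf f\mathsf x}$ is the concatenation of the files, $\mathcal U=\mathbb F_q^{\mathsf y}$, $T=\mathsf H U$ for a matrix $\mathsf H\in\mathbb F_q^{\mathsf z\times\mathsf y}$ with $T_j=\mathsf H_{\tau^{-1}(j)}U$, the full query is a matrix $Q\in\mathbb F_q^{\mathsf z\times\mathsf f\mathsf x}$ (a function of $(K,R)$) of which server $j$ receives the rows $Q_{\tau^{-1}(j)}$, and $D_j=Q_{\tau^{-1}(j)}M+T_j\in\mathbb F_q^{|\tau^{-1}(j)|}$. Its PIR rate is $\mathsf x/\mathsf z$ and its shared randomness rate is $\mathsf y/\mathsf x$. NSS protocol ($\mathsf n$ players): finite sets $\mathcal M$ (secrets), $\mathcal U$, $\mathcal S_1,\dots,\mathcal S_{\mathsf n}$ and a map $\psi:\mathcal M\times\mathcal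 U\to\prod_j\mathcal S_j$; $L\in\mathcal M$ and $U_{\mathrm{NSS}}\in\mathcal U$ are independent and uniform, and the shares are $(S_1,\dots,S_{\mathsf n})=\psi(L,U_{\mathrm{NSS}})$. It is an $(\mathfrak A,\mathfrak B,\mathsf n)$-CSNSS protocol (completely secure) if for every $\mathcal A\in\mathfrak A$ the maximum likelihood decoder of $L$ from $S_{\mathcal A}$ has error probability $0$ (i.e. $L$ is a function of $S_{\mathcal A}$), and $I(L;S_{\mathcal B})=0$ for every $\mathcal B\in\mathfrak B$. The SS rate is $\log|\mathcal M|/\sum_j\log|\mathcal S_j|$; the randomness rate is $\log|\mathcal U|/\log|\mathcal M|$. Linear NSS over $\mathbb F_q$ with position map $\tau:[\mathsf z]\to[\mathsf n]$: $\mathcal M=\mathbb F_q^{\mathsf x}$, $\mathcal U=\mathbb F_q^{\mathsf y}$, and there is a linear map $\psi:\mathbb F_q^{\mathsf x+\mathsf y}\to\mathbb F_q^{\mathsf z}$ such that, with $(Z_1,\dots,Z_{\mathsf z})=\psi(L,U_{\mathrm{NSS}})$, $S_j=(Z_i)_{i\in\tau^{-1}(j)}\in\mathbb F_q^{|\tau^{-1}(j)|}$. Its SS rate is $\mathsf x/\mathsf z$ and its randomness rate is $\mathsf y/\mathsf x$. *)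

theory Defs
  imports
    "HOL-Probability.Information"
    "Jordan_Normal_Form.DL_Submatrix"
    "Jordan_Normal_Form.VS_Connect"
begin

text \<open>The unqualified type name \<open>vec\<close> is shared with the finite Cartesian products of HOL-Analysis.\<close>

type_synonym 'a fvec = "'a Matrix.vec"
type_synonym 'a fmat = "'a Matrix.mat"

definition access_structure :: "nat \<Rightarrow> nat set set \<Rightarrow> nat set set \<Rightarrow> bool" where
  "access_structure n AA BB \<longleftrightarrow>
     AA \<subseteq> Pow {1..n} \<and> BB \<subseteq> Pow {1..n} \<and>
     (\<forall>A\<in>AA. \<forall>C. A \<subseteq> C \<and> C \<subseteq> {1..n} \<longrightarrow> C \<in> AA) \<and>
     (\<forall>B\<in>BB. \<forall>C. C \<subseteq> B \<longrightarrow> C \<in> BB) \<and>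
     AA \<inter> BB = {}"

text \<open>
  Outside of the locale \<^locale>\<open>information_space\<close>, this is the quantity written
  \<open>\<I>(X ; Y)\<close> in that locale, in bits. It is meant for random variables with finite range.
\<close>

definition mutual_info :: "'w measure \<Rightarrow> ('w \<Rightarrow> 'b) \<Rightarrow> ('w \<Rightarrow> 'c) \<Rightarrow> real" where
  "mutual_info P X Y =
     prob_space.mutual_information P 2
       (count_space (X ` space P)) (count_space (Y ` space P)) X Y"

text \<open>
  Ties between maximisers are broken by the choice made by \<^const>\<open>arg_max\<close>; for uniformly
  distributed \<open>X\<close> the error probability does not depend on how they are broken.
\<close>

definition ml_decoder :: "'w measure \<Rightarrow> 'b set \<Rightarrow> ('w \<Rightarrow> 'b) \<Rightarrow> ('w \<Rightarrow> 'c) \<Rightarrow> 'c \<Rightarrow> 'b" where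
  "ml_decoder P \<X> X Y y =
     (ARG_MAX (\<lambda>x. \<P>(w in P. Y w = y \<bar> X w = x)) x. x \<in> \<X>)"

definition ml_error :: "'w measure \<Rightarrow> 'b set \<Rightarrow> ('w \<Rightarrow> 'b) \<Rightarrow> ('w \<Rightarrow> 'c) \<Rightarrow> real" where
  "ml_error P \<X> X Y = \<P>(w in P. ml_decoder P \<X> X Y (Y w) \<noteq> X w)"

text \<open>
  Servers are numbered by \<open>{1..n}\<close> and files by \<open>{1..f}\<close>. Tuples over servers are functions
  whose values outside \<open>{1..n}\<close> are irrelevant.
\<close>

record ('m, 'u, 'r, 't, 'q, 'd) spir =
  file_set :: "'m set"
  seed_set :: "'u set"
  user_set :: "'r set"
  srand_set :: "nat \<Rightarrow> 't set"
  query_set :: "nat \<Rightarrow> 'q set"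
  answer_set :: "nat \<Rightarrow> 'd set"
  srand_map :: "'u \<Rightarrow> nat \<Rightarrow> 't"
  query_map :: "nat \<Rightarrow> 'r \<Rightarrow> nat \<Rightarrow> 'q"
  answer_map :: "nat \<Rightarrow> 'q \<Rightarrow> (nat \<Rightarrow> 'm) \<Rightarrow> 't \<Rightarrow> 'd"

definition file_tuples :: "nat \<Rightarrow> ('m, 'u, 'r, 't, 'q, 'd) spir \<Rightarrow> (nat \<Rightarrow> 'm) set" where
  "file_tuples f \<Phi> = (\<Pi>\<^sub>E i\<in>{1..f}. file_set \<Phi>)"

definition spir_protocol :: "nat \<Rightarrow> nat \<Rightarrow> ('m, 'u, 'r, 't, 'q, 'd) spir \<Rightarrow> bool" where
  "spir_protocol n f \<Phi> \<longleftrightarrow>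
     finite (file_set \<Phi>) \<and> file_set \<Phi> \<noteq> {} \<and>
     finite (seed_set \<Phi>) \<and> seed_set \<Phi> \<noteq> {} \<and>
     finite (user_set \<Phi>) \<and> user_set \<Phi> \<noteq> {} \<and>
     (\<forall>j\<in>{1..n}. finite (srand_set \<Phi> j) \<and> finite (query_set \<Phi> j) \<and> finite (answer_set \<Phi> j)) \<and>
     (\<forall>u\<in>seed_set \<Phi>. \<forall>j\<in>{1..n}. srand_map \<Phi> u j \<in> srand_set \<Phi> j) \<and>
     (\<forall>k\<in>{1..f}. \<forall>r\<in>user_set \<Phi>. \<forall>j\<in>{1..n}. query_map \<Phi> k r j \<in> query_set \<Phi> j) \<and>
     (\<forall>j\<in>{1..n}. \<forall>q\<in>query_set \<Phi> j. \<forall>m\<in>file_tuples f \<Phi>. \<forall>t\<in>srand_set \<Phi> j.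
        answer_map \<Phi> j q m t \<in> answer_set \<Phi> j)"

text \<open>
  An outcome \<open>(m, u, k, r)\<close> consists of the values of \<open>M\<close>, \<open>U\<close>, \<open>K\<close>, \<open>R\<close>, which are uniform
  and independent because the product set carries the uniform distribution.
\<close>

type_synonym ('m, 'u, 'r) spir_outcome = "(nat \<Rightarrow> 'm) \<times> 'u \<times> nat \<times> 'r"

definition spir_space ::
    "nat \<Rightarrow> ('m, 'u, 'r, 't, 'q, 'd) spir \<Rightarrow> ('m, 'u, 'r) spir_outcome measure" where
  "spir_space f \<Phi> =
     uniform_count_measure (file_tuples f \<Phi> \<times> seed_set \<Phi> \<times> {1..f} \<times> user_set \<Phi>)"

definition files_rv :: "('m, 'u, 'r) spir_outcome \<Rightarrow> nat \<Rightarrow> 'm" where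
  "files_rv = (\<lambda>(m, u, k, r). m)"

definition index_rv :: "('m, 'u, 'r) spir_outcome \<Rightarrow> nat" where
  "index_rv = (\<lambda>(m, u, k, r). k)"

definition user_rv :: "('m, 'u, 'r) spir_outcome \<Rightarrow> 'r" where
  "user_rv = (\<lambda>(m, u, k, r). r)"

definition query_rv ::
    "('m, 'u, 'r, 't, 'q, 'd) spir \<Rightarrow> ('m, 'u, 'r) spir_outcome \<Rightarrow> nat \<Rightarrow> 'q" where
  "query_rv \<Phi> = (\<lambda>(m, u, k, r) j. query_map \<Phi> k r j)"

definition answer_rv ::
    "('m, 'u, 'r, 't, 'q, 'd) spir \<Rightarrow> ('m, 'u, 'r) spir_outcome \<Rightarrow> nat \<Rightarrow> 'd" where
  "answer_rv \<Phi> = (\<lambda>(m, u, k, r) j. answer_map \<Phi> j (query_map \<Phi> k r j) m (srand_map \<Phi> u j))"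

definition spir_cond_space ::
    "nat \<Rightarrow> ('m, 'u, 'r, 't, 'q, 'd) spir \<Rightarrow> nat \<Rightarrow> 'r \<Rightarrow> ('m, 'u, 'r) spir_outcome measure" where
  "spir_cond_space f \<Phi> k r =
     uniform_measure (spir_space f \<Phi>)
       {w \<in> space (spir_space f \<Phi>). index_rv w = k \<and> user_rv w = r}"

definition spir_correct ::
    "nat set set \<Rightarrow> nat \<Rightarrow> ('m, 'u, 'r, 't, 'q, 'd) spir \<Rightarrow> bool" where
  "spir_correct AA f \<Phi> \<longleftrightarrow>
     (\<forall>r\<in>user_set \<Phi>. \<forall>k\<in>{1..f}. \<forall>A\<in>AA.
        ml_error (spir_cond_space f \<Phi> k r) (file_set \<Phi>)
          (\<lambda>w. files_rv w k) (\<lambda>w. restrict (answer_rv \<Phi> w) A) = 0)"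

definition spir_server_secret ::
    "nat \<Rightarrow> nat \<Rightarrow> ('m, 'u, 'r, 't, 'q, 'd) spir \<Rightarrow> bool" where
  "spir_server_secret n f \<Phi> \<longleftrightarrow>
     (\<forall>r\<in>user_set \<Phi>. \<forall>k\<in>{1..f}.
        mutual_info (spir_cond_space f \<Phi> k r)
          (\<lambda>w. restrict (answer_rv \<Phi> w) {1..n})
          (\<lambda>w. restrict (files_rv w) ({1..f} - {k})) = 0)"

definition spir_user_secret ::
    "nat set set \<Rightarrow> nat \<Rightarrow> ('m, 'u, 'r, 't, 'q, 'd) spir \<Rightarrow> bool" where
  "spir_user_secret BB f \<Phi> \<longleftrightarrow>
     (\<forall>B\<in>BB. mutual_info (spir_space f \<Phi>) index_rv (\<lambda>w. restrict (query_rv \<Phi> w) B) = 0)"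

definition csspir_protocol ::
    "nat set set \<Rightarrow> nat set set \<Rightarrow> nat \<Rightarrow> nat \<Rightarrow> ('m, 'u, 'r, 't, 'q, 'd) spir \<Rightarrow> bool" where
  "csspir_protocol AA BB n f \<Phi> \<longleftrightarrow>
     spir_protocol n f \<Phi> \<and> spir_correct AA f \<Phi> \<and>
     spir_server_secret n f \<Phi> \<and> spir_user_secret BB f \<Phi>"

definition pir_rate :: "nat \<Rightarrow> ('m, 'u, 'r, 't, 'q, 'd) spir \<Rightarrow> real" where
  "pir_rate n \<Phi> =
     log 2 (real (card (file_set \<Phi>))) / (\<Sum>j\<in>{1..n}. log 2 (real (card (answer_set \<Phi> j))))"

definition shared_randomness_rate :: "('m, 'u, 'r, 't, 'q, 'd) spir \<Rightarrow> real" where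
  "shared_randomness_rate \<Phi> =
     log 2 (real (card (seed_set \<Phi>))) / log 2 (real (card (file_set \<Phi>)))"

record ('m, 'u, 's) nss =
  secret_set :: "'m set"
  dealer_set :: "'u set"
  share_set :: "nat \<Rightarrow> 's set"
  share_map :: "'m \<Rightarrow> 'u \<Rightarrow> nat \<Rightarrow> 's"

definition nss_protocol :: "nat \<Rightarrow> ('m, 'u, 's) nss \<Rightarrow> bool" where
  "nss_protocol n \<Psi> \<longleftrightarrow>
     finite (secret_set \<Psi>) \<and> secret_set \<Psi> \<noteq> {} \<and>
     finite (dealer_set \<Psi>) \<and> dealer_set \<Psi> \<noteq> {} \<and>
     (\<forall>j\<in>{1..n}. finite (share_set \<Psi> j)) \<and>
     (\<forall>l\<in>secret_set \<Psi>. \<forall>u\<in>dealer_set \<Psi>. \<forall>j\<in>{1..n}. share_map \<Psi> l u j \<in> share_set \<Psi> j)"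

definition nss_space :: "('m, 'u, 's) nss \<Rightarrow> ('m \<times> 'u) measure" where
  "nss_space \<Psi> = uniform_count_measure (secret_set \<Psi> \<times> dealer_set \<Psi>)"

definition shares_rv :: "('m, 'u, 's) nss \<Rightarrow> 'm \<times> 'u \<Rightarrow> nat \<Rightarrow> 's" where
  "shares_rv \<Psi> = (\<lambda>(l, u). share_map \<Psi> l u)"

definition csnss_protocol ::
    "nat set set \<Rightarrow> nat set set \<Rightarrow> nat \<Rightarrow> ('m, 'u, 's) nss \<Rightarrow> bool" where
  "csnss_protocol AA BB n \<Psi> \<longleftrightarrow>
     nss_protocol n \<Psi> \<and>
     (\<forall>A\<in>AA. ml_error (nss_space \<Psi>) (secret_set \<Psi>) fst (\<lambda>w. restrict (shares_rv \<Psi> w) A) = 0) \<and>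
     (\<forall>B\<in>BB. mutual_info (nss_space \<Psi>) fst (\<lambda>w. restrict (shares_rv \<Psi> w) B) = 0)"

definition ss_rate :: "nat \<Rightarrow> ('m, 'u, 's) nss \<Rightarrow> real" where
  "ss_rate n \<Psi> =
     log 2 (real (card (secret_set \<Psi>))) / (\<Sum>j\<in>{1..n}. log 2 (real (card (share_set \<Psi> j))))"

definition nss_randomness_rate :: "('m, 'u, 's) nss \<Rightarrow> real" where
  "nss_randomness_rate \<Psi> =
     log 2 (real (card (dealer_set \<Psi>))) / log 2 (real (card (secret_set \<Psi>)))"

text \<open>
  Matrix rows and vector entries are counted from 0, so a position map is a function from
  \<open>{..<z}\<close> to \<open>{1..n}\<close>.
\<close>

definition positions :: "nat \<Rightarrow> (nat \<Rightarrow> nat) \<Rightarrow> nat \<Rightarrow> nat set" where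
  "positions z \<tau> j = {i. i < z \<and> \<tau> i = j}"

definition row_submatrix :: "'a fmat \<Rightarrow> nat set \<Rightarrow> 'a fmat" where
  "row_submatrix A I = submatrix A I UNIV"

definition subvector :: "'a fvec \<Rightarrow> nat set \<Rightarrow> 'a fvec" where
  "subvector v I = Matrix.vec (card I) (\<lambda>i. vec_index v (pick I i))"

definition concat_files :: "nat \<Rightarrow> nat \<Rightarrow> (nat \<Rightarrow> 'a fvec) \<Rightarrow> 'a fvec" where
  "concat_files f x m = Matrix.vec (f * x) (\<lambda>i. vec_index (m (i div x + 1)) (i mod x))"

definition linear_spir ::
    "nat \<Rightarrow> nat \<Rightarrow> nat \<Rightarrow> nat \<Rightarrow> nat \<Rightarrow> (nat \<Rightarrow> nat) \<Rightarrow>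
     ('a::{field, finite} fvec, 'a fvec, 'r, 'a fvec, 'a fmat, 'a fvec) spir \<Rightarrow> bool" where
  "linear_spir n f x y z \<tau> \<Phi> \<longleftrightarrow>
     spir_protocol n f \<Phi> \<and>
     \<tau> \<in> {..<z} \<rightarrow> {1..n} \<and>
     file_set \<Phi> = carrier_vec x \<and>
     seed_set \<Phi> = carrier_vec y \<and>
     (\<forall>j\<in>{1..n}.
        srand_set \<Phi> j = carrier_vec (card (positions z \<tau> j)) \<and>
        query_set \<Phi> j = carrier_mat (card (positions z \<tau> j)) (f * x) \<and>
        answer_set \<Phi> j = carrier_vec (card (positions z \<tau> j))) \<and>
     (\<exists>H \<in> carrier_mat z y. \<forall>u \<in> carrier_vec y. \<forall>j\<in>{1..n}.
        srand_map \<Phi> u j = row_submatrix H (positions z \<tau> j) *\<^sub>v u) \<and>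
     (\<exists>Q. \<forall>k\<in>{1..f}. \<forall>r\<in>user_set \<Phi>.
        Q k r \<in> carrier_mat z (f * x) \<and>
        (\<forall>j\<in>{1..n}. query_map \<Phi> k r j = row_submatrix (Q k r) (positions z \<tau> j))) \<and>
     (\<forall>j\<in>{1..n}. \<forall>q\<in>query_set \<Phi> j. \<forall>m\<in>file_tuples f \<Phi>. \<forall>t\<in>srand_set \<Phi> j.
        answer_map \<Phi> j q m t = q *\<^sub>v concat_files f x m + t)"

definition linear_nss ::
    "nat \<Rightarrow> nat \<Rightarrow> nat \<Rightarrow> nat \<Rightarrow> (nat \<Rightarrow> nat) \<Rightarrow>
     ('a::{field, finite} fvec, 'a fvec, 'a fvec) nss \<Rightarrow> bool" where
  "linear_nss n x y z \<tau> \<Psi> \<longleftrightarrow>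
     nss_protocol n \<Psi> \<and>
     \<tau> \<in> {..<z} \<rightarrow> {1..n} \<and>
     secret_set \<Psi> = carrier_vec x \<and>
     dealer_set \<Psi> = carrier_vec y \<and>
     (\<forall>j\<in>{1..n}. share_set \<Psi> j = carrier_vec (card (positions z \<tau> j))) \<and>
     (\<exists>\<psi>. linear_map class_ring (module_vec TYPE('a) (x + y)) (module_vec TYPE('a) z) \<psi> \<and>
        (\<forall>l \<in> carrier_vec x. \<forall>u \<in> carrier_vec y. \<forall>j\<in>{1..n}.
           share_map \<Psi> l u j = subvector (\<psi> (l @\<^sub>v u)) (positions z \<tau> j)))"

definition nss_of_spir ::
    "nat \<Rightarrow> nat \<Rightarrow> 'r \<Rightarrow>
     ('a::{field, finite} fvec, 'a fvec, 'r, 'a fvec, 'a fmat, 'a fvec) spir \<Rightarrow>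
     ('a fvec, 'a fvec, 'a fvec) nss" where
  "nss_of_spir f x r0 \<Phi> =
     \<lparr> secret_set = file_set \<Phi>,
       dealer_set = seed_set \<Phi>,
       share_set = answer_set \<Phi>,
       share_map = (\<lambda>l u j.
         answer_rv \<Phi> (\<lambda>i\<in>{1..f}. if i = 1 then l else 0\<^sub>v x, u, 1, r0) j) \<rparr>"

end

theory Submission
  imports Defs
begin

text \<open>
  The answers are \<open>Q M + H U\<close>. By server secrecy, the answer 0 is compatible with every value of
  the files that are not requested, and by correctness the requested file is then 0. Hence the part
  of the answers that comes from a non-requested file lies in the image of \<open>H\<close>, i.e. it can be
  cancelled by a choice of the seed. By user secrecy, servers in a set \<open>B \<in> BB\<close> that see the
  queries for file 1 might equally well be answering a query for file 2, so on \<open>B\<close> the secret,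
  placed in file 1, only translates the seed, which is uniform.
\<close>

section \<open>Zero error of the maximum likelihood decoder\<close>

lemma ml_error_eq_0D:
  assumes "finite_measure P" "sets P = Pow (space P)" "ml_error P S X Y = 0"
    and "w \<in> space P" "measure P {w} > 0"
  shows "ml_decoder P S X Y (Y w) = X w"
proof (rule ccontr)
  assume "ml_decoder P S X Y (Y w) \<noteq> X w"
  \<comment> \<open>The wrongly decoded outcome \<open>w\<close> alone contributes its positive mass
    to the error probability.\<close>
  then have "measure P {w} \<le> ml_error P S X Y"
    unfolding ml_error_def using assms
    by (intro finite_measure.finite_measure_mono) auto
  then show False
    using assms by simp
qed

text \<open>An observed \<open>Y w\<close> is compatible with the value \<open>X w\<close> only, so
  every other value has likelihood 0 and the maximiser is unique. The choice made by
  \<open>arg_max\<close> therefore does not matter.\<close>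

lemma ml_error_eq_0I:
  assumes P: "finite_measure P" "sets P = Pow (space P)"
    and pos: "\<And>w. w \<in> space P \<Longrightarrow> measure P {w} > 0"
    and X: "\<And>w. w \<in> space P \<Longrightarrow> X w \<in> S"
    and determined: "\<And>w w'. w \<in> space P \<Longrightarrow> w' \<in> space P \<Longrightarrow> Y w = Y w' \<Longrightarrow> X w = X w'"
  shows "ml_error P S X Y = 0"
proof -
  interpret finite_measure P by fact
  have mono: "{w} \<subseteq> A \<Longrightarrow> A \<subseteq> space P \<Longrightarrow> w \<in> space P \<Longrightarrow> measure P A > 0" for w A
    using pos[of w] finite_measure_mono[of "{w}" A] P by auto
  have "ml_decoder P S X Y (Y w) = X w" if w: "w \<in> space P" for w
  proof -
    let ?f = "\<lambda>x. \<P>(v in P. Y v = Y w \<bar> X v = x)"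
    have f0: "?f x = 0" if "x \<noteq> X w" for x
    proof -
      \<comment> \<open>The numerator of the conditional probability is the measure of the empty
        set, so the quotient is 0 even when \<open>X v = x\<close> is a null event.\<close>
      have "{v \<in> space P. Y v = Y w \<and> X v = x} = {}"
        using determined w that by blast
      then show ?thesis
        unfolding cond_prob_def by (metis div_0 measure_empty)
    qed
    have f1: "?f (X w) > 0"
      unfolding cond_prob_def using w by (intro divide_pos_pos mono[of w]) auto
    have "is_arg_max ?f (\<lambda>x. x \<in> S) (X w)"
      unfolding is_arg_max_def using X[OF w] f0 f1 by (metis less_asym)
    moreover have "x = X w" if "is_arg_max ?f (\<lambda>x. x \<in> S) x" for x
      using that f0 f1 X[OF w] unfolding is_arg_max_def by metis
    ultimately show ?thesis
      unfolding ml_decoder_def arg_max_def by (rule some_equality)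
  qed
  then have "{w \<in> space P. ml_decoder P S X Y (Y w) \<noteq> X w} = {}"
    by blast
  then show ?thesis
    unfolding ml_error_def by (metis measure_empty)
qed

section \<open>Zero mutual information on a finite probability space\<close>

lemma simple_distributed_prob_eq:
  assumes "prob_space P" "finite (space P)" "sets P = Pow (space P)"
  shows "simple_distributed P Z (\<lambda>z. measure P {w \<in> space P. Z w = z})"
proof -
  interpret prob_space P by fact
  show ?thesis
    by (rule simple_distributedI)
      (auto simp: simple_function_def assms intro!: arg_cong[where f="measure P"])
qed

text \<open>
  If the pair \<open>(X v, Y w)\<close> were missed by the support \<open>J\<close> of the joint distribution, the product
  distribution would have mass less than 1 on \<open>J\<close>, and the inequality \<open>ln t \<le> t - 1\<close> would make
  the mutual information positive.
\<close>

lemma mutual_info_eq_0_jointly_attained: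
  assumes P: "prob_space P" "finite (space P)" "sets P = Pow (space P)"
    and MI: "mutual_info P X Y = 0"
    and v: "v \<in> space P" "measure P {v} > 0" and w: "w \<in> space P" "measure P {w} > 0"
  obtains u where "u \<in> space P" "measure P {u} > 0" "X u = X v" "Y u = Y w"
proof -
  interpret prob_space P by fact
  interpret information_space P 2 by standard simp
  note sd = simple_distributed_prob_eq[OF P]
  define px where "px = (\<lambda>a. measure P {w \<in> space P. X w = a})"
  define py where "py = (\<lambda>b. measure P {w \<in> space P. Y w = b})"
  define p where "p = (\<lambda>c. measure P {w \<in> space P. (X w, Y w) = c})"
  define q where "q = (\<lambda>(a, b). px a * py b)"
  define J where "J = (\<lambda>u. (X u, Y u)) ` {u \<in> space P. measure P {u} > 0}"
  let ?A = "X ` space P \<times> Y ` space P"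
  have q_nonneg: "q c \<ge> 0" for c
    unfolding q_def px_def py_def by (simp add: split_beta)
  have pos: "measure P {w \<in> space P. R w} > 0" if "u \<in> space P" "measure P {u} > 0" "R u" for u R
    using that P(3) by (intro less_le_trans[OF that(2) finite_measure_mono]) auto
  have JA: "J \<subseteq> (\<lambda>u. (X u, Y u)) ` space P" "J \<subseteq> ?A"
    unfolding J_def by auto
  have finA: "finite ?A"
    using P(2) by simp
  have p_pos: "p c > 0" if "c \<in> J" for c
    using that unfolding J_def p_def by (auto intro: pos)
  have q_pos: "q c > 0" if "c \<in> J" for c
    using that unfolding J_def q_def px_def py_def by (auto intro!: mult_pos_pos intro: pos)
  have p_0: "p c = 0" if "c \<notin> J" for c
  proof -
    have "p c = (\<Sum>u\<in>{w \<in> space P. (X w, Y w) = c}. measure P {u})"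
      unfolding p_def using P by (intro finite_measure_eq_sum_singleton) auto
    also have "\<dots> = 0"
    proof (intro sum.neutral ballI)
      fix u assume "u \<in> {w \<in> space P. (X w, Y w) = c}"
      then have "\<not> measure P {u} > 0"
        using that unfolding J_def by blast
      then show "measure P {u} = 0"
        by (simp add: zero_less_measure_iff)
    qed
    finally show ?thesis .
  qed
  \<comment> \<open>Mutual information is the divergence of the joint distribution \<open>p\<close>
    from the product \<open>q\<close>. Only \<open>J\<close> contributes to the sum, because
    \<open>p\<close> vanishes off \<open>J\<close>.\<close>
  have "(\<Sum>c\<in>(\<lambda>u. (X u, Y u)) ` space P. p c * log 2 (p c / q c)) = 0"
    using mutual_information_simple_distributed[OF sd[of X] sd[of Y] sd[of "\<lambda>u. (X u, Y u)"]] MI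
    unfolding mutual_info_def p_def q_def px_def py_def by (simp add: split_beta prod_eq_iff)
  moreover have "(\<Sum>c\<in>J. p c * log 2 (p c / q c)) =
      (\<Sum>c\<in>(\<lambda>u. (X u, Y u)) ` space P. p c * log 2 (p c / q c))"
    using P(2) JA(1) by (intro sum.mono_neutral_left) (auto simp: p_0)
  ultimately have "(\<Sum>c\<in>J. p c * log 2 (p c / q c)) = 0"
    by simp
  then have "(\<Sum>c\<in>J. p c * ln (p c / q c)) / ln 2 = 0"
    by (simp add: log_def sum_divide_distrib)
  then have "(\<Sum>c\<in>J. p c * ln (p c / q c)) = 0"
    by simp
  \<comment> \<open>The inequality is used at \<open>t = q c / p c\<close> and multiplied by
    \<open>p c\<close>. Summed over \<open>J\<close>, it bounds the mass of \<open>p\<close> on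
    \<open>J\<close>, which is 1, by the mass of \<open>q\<close> on \<open>J\<close>.\<close>
  moreover have "p c - q c \<le> p c * ln (p c / q c)" if "c \<in> J" for c
  proof -
    have "ln (q c / p c) \<le> q c / p c - 1"
      using that p_pos q_pos by (intro ln_le_minus_one) simp
    then have "p c * ln (q c / p c) \<le> p c * (q c / p c - 1)"
      using p_pos[OF that] by (intro mult_left_mono) auto
    also have "\<dots> = q c - p c"
      using p_pos[OF that] by (simp add: field_simps)
    finally show ?thesis
      using p_pos[OF that] q_pos[OF that] by (simp add: ln_div algebra_simps)
  qed
  ultimately have "(\<Sum>c\<in>J. p c - q c) \<le> 0"
    using sum_mono[of J "\<lambda>c. p c - q c" "\<lambda>c. p c * ln (p c / q c)"] by simp
  moreover have "(\<Sum>c\<in>J. p c) = 1"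
  proof -
    have "(\<Sum>c\<in>J. p c) = (\<Sum>c\<in>(\<lambda>u. (X u, Y u)) ` space P. p c)"
      using P(2) JA(1) by (intro sum.mono_neutral_left) (auto simp: p_0)
    then show ?thesis
      using simple_distributed_sum_space[OF sd[of "\<lambda>u. (X u, Y u)"]] unfolding p_def by simp
  qed
  ultimately have J1: "(\<Sum>c\<in>J. q c) \<ge> 1"
    by (simp add: sum_subtractf)
  have "(\<Sum>c\<in>?A. q c) = (\<Sum>a\<in>X ` space P. px a) * (\<Sum>b\<in>Y ` space P. py b)"
    unfolding q_def by (simp add: sum_product sum.cartesian_product)
  then have A1: "(\<Sum>c\<in>?A. q c) = 1"
    using simple_distributed_sum_space[OF sd[of X]] simple_distributed_sum_space[OF sd[of Y]]
    unfolding px_def py_def by simp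
  have "(X v, Y w) \<in> J"
  proof (rule ccontr)
    assume "(X v, Y w) \<notin> J"
    moreover have "q (X v, Y w) > 0"
      unfolding q_def px_def py_def using v w by (auto intro!: mult_pos_pos intro: pos)
    ultimately have "(\<Sum>c\<in>J. q c) < (\<Sum>c\<in>?A. q c)"
      using v w by (intro sum_strict_mono2[OF finA JA(2), of "(X v, Y w)"]) (auto intro: q_nonneg)
    then show False
      using J1 A1 by simp
  qed
  then show thesis
    using that unfolding J_def by auto
qed

lemma mutual_info_eq_0I:
  assumes P: "prob_space P" "finite (space P)" "sets P = Pow (space P)"
    and indep: "\<And>v. v \<in> space P \<Longrightarrow> measure P {w \<in> space P. X w = X v \<and> Y w = Y v} =
      measure P {w \<in> space P. X w = X v} * measure P {w \<in> space P. Y w = Y v}"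
  shows "mutual_info P X Y = 0"
proof -
  interpret prob_space P by fact
  interpret information_space P 2 by standard simp
  note sd = simple_distributed_prob_eq[OF P]
  show ?thesis
    unfolding mutual_info_def
    by (rule mutual_information_eq_0_simple[OF sd sd sd]) (use indep in auto)
qed

lemma uniform_count_measure_facts:
  assumes "finite A" "A \<noteq> {}"
  shows "prob_space (uniform_count_measure A)" "finite (space (uniform_count_measure A))"
    "sets (uniform_count_measure A) = Pow (space (uniform_count_measure A))"
    "w \<in> A \<Longrightarrow> measure (uniform_count_measure A) {w} > 0"
  using assms prob_space_uniform_count_measure
  by (auto simp: space_uniform_count_measure sets_uniform_count_measure
      measure_uniform_count_measure card_gt_0_iff)

section \<open>What the SPIR conditions say about single outcomes\<close>

lemma spir_outcomes:
  assumes "spir_protocol n f \<Phi>" "1 \<le> f"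
  shows "finite (file_tuples f \<Phi> \<times> seed_set \<Phi> \<times> {1..f} \<times> user_set \<Phi>)"
    "file_tuples f \<Phi> \<times> seed_set \<Phi> \<times> {1..f} \<times> user_set \<Phi> \<noteq> {}"
  using assms unfolding spir_protocol_def file_tuples_def
  by (auto intro!: finite_PiE simp: PiE_eq_empty_iff Times_eq_image_sum)

text \<open>Since \<open>uniform_measure\<close> keeps the underlying space, conditioning on
  \<open>K = k\<close> and \<open>R = r\<close> leaves outcomes of mass 0 in it. The last fact
  singles out those of positive mass; this is why the lemmas that exploit zero error or zero
  information ask for positive mass.\<close>

lemma spir_cond_space_facts:
  assumes "spir_protocol n f \<Phi>" and kr: "k \<in> {1..f}" "r \<in> user_set \<Phi>"
  shows "prob_space (spir_cond_space f \<Phi> k r)" "finite (space (spir_cond_space f \<Phi> k r))"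
    "sets (spir_cond_space f \<Phi> k r) = Pow (space (spir_cond_space f \<Phi> k r))"
    "space (spir_cond_space f \<Phi> k r) =
      file_tuples f \<Phi> \<times> seed_set \<Phi> \<times> {1..f} \<times> user_set \<Phi>"
    "w \<in> space (spir_cond_space f \<Phi> k r) \<Longrightarrow>
      measure (spir_cond_space f \<Phi> k r) {w} > 0 \<longleftrightarrow> index_rv w = k \<and> user_rv w = r"
proof -
  have f: "1 \<le> f"
    using kr by simp
  let ?\<Omega> = "file_tuples f \<Phi> \<times> seed_set \<Phi> \<times> {1..f} \<times> user_set \<Phi>"
  let ?P = "spir_space f \<Phi>"
  let ?E = "{w \<in> space ?P. index_rv w = k \<and> user_rv w = r}"
  note P = uniform_count_measure_facts[OF spir_outcomes[OF assms(1) f], folded spir_space_def]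
  interpret prob_space ?P by fact
  have sp: "space ?P = ?\<Omega>"
    by (simp add: spir_space_def space_uniform_count_measure)
  obtain m u where mu: "m \<in> file_tuples f \<Phi>" "u \<in> seed_set \<Phi>"
    using spir_outcomes[OF assms(1) f] by auto
  \<comment> \<open>One outcome inside the conditioning event shows that the event is not
    null.\<close>
  have "measure ?P {(m, u, k, r)} \<le> measure ?P ?E"
    using mu kr P(3) by (intro finite_measure_mono) (auto simp: sp index_rv_def user_rv_def)
  then have E: "measure ?P ?E > 0"
    using P(4)[of "(m, u, k, r)"] mu kr by simp
  then have E': "emeasure ?P ?E \<noteq> 0" "emeasure ?P ?E \<noteq> \<infinity>"
    by (auto simp: emeasure_eq_measure)
  show "prob_space (spir_cond_space f \<Phi> k r)"
    unfolding spir_cond_space_def by (rule prob_space_uniform_measure[OF E'])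
  show "finite (space (spir_cond_space f \<Phi> k r))"
    "sets (spir_cond_space f \<Phi> k r) = Pow (space (spir_cond_space f \<Phi> k r))"
    "space (spir_cond_space f \<Phi> k r) = ?\<Omega>"
    unfolding spir_cond_space_def using P sp by simp_all
  assume w: "w \<in> space (spir_cond_space f \<Phi> k r)"
  then have w': "w \<in> space ?P"
    unfolding spir_cond_space_def by simp
  then have "measure (spir_cond_space f \<Phi> k r) {w} = measure ?P (?E \<inter> {w}) / measure ?P ?E"
    unfolding spir_cond_space_def using E' P(3) by (intro measure_uniform_measure) auto
  then show "measure (spir_cond_space f \<Phi> k r) {w} > 0 \<longleftrightarrow> index_rv w = k \<and> user_rv w = r"
    using w' E P(4)[of w] by (cases "w \<in> ?E") (simp_all add: sp)
qed

text \<open>The decoder sees nothing but the answers in \<open>A\<close>, so it returns the same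
  value for both outcomes; both have positive mass given \<open>k\<close> and \<open>r\<close>, so
  this value is the requested file of each.\<close>

lemma spir_correctD:
  assumes \<Phi>: "spir_protocol n f \<Phi>" "spir_correct AA f \<Phi>"
    and kr: "k \<in> {1..f}" "r \<in> user_set \<Phi>" and A: "A \<in> AA"
    and m: "m \<in> file_tuples f \<Phi>" "m' \<in> file_tuples f \<Phi>"
    and u: "u \<in> seed_set \<Phi>" "u' \<in> seed_set \<Phi>"
    and eq: "\<And>j. j \<in> A \<Longrightarrow> answer_rv \<Phi> (m, u, k, r) j = answer_rv \<Phi> (m', u', k, r) j"
  shows "m k = m' k"
proof -
  let ?P = "spir_cond_space f \<Phi> k r" and ?D = "\<lambda>w. restrict (answer_rv \<Phi> w) A"
  let ?dec = "ml_decoder ?P (file_set \<Phi>) (\<lambda>w. files_rv w k) ?D"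
  note P = spir_cond_space_facts[OF \<Phi>(1) kr]
  have err: "ml_error ?P (file_set \<Phi>) (\<lambda>w. files_rv w k) ?D = 0"
    using \<Phi>(2) kr A unfolding spir_correct_def by blast
  have dec: "?dec (?D (m, u, k, r)) = m k"
    if "m \<in> file_tuples f \<Phi>" "u \<in> seed_set \<Phi>" for m u
    using ml_error_eq_0D[OF prob_space.finite_measure[OF P(1)] P(3) err, of "(m, u, k, r)"]
      that kr P(4) P(5)[of "(m, u, k, r)"] by (simp add: files_rv_def index_rv_def user_rv_def)
  have "?D (m, u, k, r) = ?D (m', u', k, r)"
    using eq by (intro restrict_ext)
  then show ?thesis
    using dec m u by metis
qed

text \<open>Given \<open>k\<close> and \<open>r\<close>, the answers to \<open>m\<close> and the
  non-requested files of \<open>m'\<close> each occur with positive probability, and zero mutual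
  information makes them occur together. Nothing is said about the requested file
  \<open>m'' k\<close>.\<close>

lemma spir_server_secretD:
  assumes \<Phi>: "spir_protocol n f \<Phi>" "spir_server_secret n f \<Phi>"
    and kr: "k \<in> {1..f}" "r \<in> user_set \<Phi>"
    and m: "m \<in> file_tuples f \<Phi>" "m' \<in> file_tuples f \<Phi>" and u: "u \<in> seed_set \<Phi>"
  obtains m'' u'' where "m'' \<in> file_tuples f \<Phi>" "u'' \<in> seed_set \<Phi>"
    "\<And>j. j \<in> {1..n} \<Longrightarrow> answer_rv \<Phi> (m'', u'', k, r) j = answer_rv \<Phi> (m, u, k, r) j"
    "\<And>i. i \<in> {1..f} - {k} \<Longrightarrow> m'' i = m' i"
proof -
  let ?P = "spir_cond_space f \<Phi> k r"
  note P = spir_cond_space_facts[OF \<Phi>(1) kr]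
  have pos: "(m, u, k, r) \<in> space ?P" "measure ?P {(m, u, k, r)} > 0"
    if "m \<in> file_tuples f \<Phi>" for m
    using that u kr P(4) P(5)[of "(m, u, k, r)"] by (simp_all add: index_rv_def user_rv_def)
  have "mutual_info ?P (\<lambda>w. restrict (answer_rv \<Phi> w) {1..n})
      (\<lambda>w. restrict (files_rv w) ({1..f} - {k})) = 0"
    using \<Phi>(2) kr unfolding spir_server_secret_def by blast
  then obtain w where w: "w \<in> space ?P" "measure ?P {w} > 0"
      "restrict (answer_rv \<Phi> w) {1..n} = restrict (answer_rv \<Phi> (m, u, k, r)) {1..n}"
      "restrict (files_rv w) ({1..f} - {k}) = restrict (files_rv (m', u, k, r)) ({1..f} - {k})"
    by (rule mutual_info_eq_0_jointly_attained[OF P(1-3) _ pos[OF m(1)] pos[OF m(2)]])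
  obtain m'' u'' k' r' where w_eq: "w = (m'', u'', k', r')"
    by (metis prod_cases4)
  have "k' = k" "r' = r"
    using P(5)[OF w(1)] w(2) w_eq by (auto simp: index_rv_def user_rv_def)
  then have w_eq: "w = (m'', u'', k, r)"
    using w_eq by simp
  show thesis
  proof
    show "m'' \<in> file_tuples f \<Phi>" "u'' \<in> seed_set \<Phi>"
      using w(1) w_eq P(4) by auto
    show "answer_rv \<Phi> (m'', u'', k, r) j = answer_rv \<Phi> (m, u, k, r) j" if "j \<in> {1..n}" for j
      using fun_cong[OF w(3), of j] that by (simp add: w_eq)
    show "m'' i = m' i" if "i \<in> {1..f} - {k}" for i
      using fun_cong[OF w(4), of i] that by (simp add: w_eq files_rv_def)
  qed
qed

text \<open>The index \<open>k'\<close> and the queries that \<open>(k, r)\<close> sends to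
  \<open>B\<close> each occur with positive probability, hence also jointly; \<open>r'\<close> is
  the user randomness of such a joint outcome.\<close>

lemma spir_user_secretD:
  assumes \<Phi>: "spir_protocol n f \<Phi>" "spir_user_secret BB f \<Phi>"
    and k: "k \<in> {1..f}" "k' \<in> {1..f}" and r: "r \<in> user_set \<Phi>" and B: "B \<in> BB"
  obtains r' where "r' \<in> user_set \<Phi>"
    "\<And>j. j \<in> B \<Longrightarrow> query_map \<Phi> k' r' j = query_map \<Phi> k r j"
proof -
  have f: "1 \<le> f"
    using k by simp
  note \<Omega> = spir_outcomes[OF \<Phi>(1) f]
  note P = uniform_count_measure_facts[OF \<Omega>, folded spir_space_def]
  have sp: "space (spir_space f \<Phi>) = file_tuples f \<Phi> \<times> seed_set \<Phi> \<times> {1..f} \<times> user_set \<Phi>"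
    by (simp add: spir_space_def space_uniform_count_measure)
  obtain m u where mu: "m \<in> file_tuples f \<Phi>" "u \<in> seed_set \<Phi>"
    using \<Omega> by auto
  have pos: "(m, u, k, r) \<in> space (spir_space f \<Phi>)" "measure (spir_space f \<Phi>) {(m, u, k, r)} > 0"
    if "k \<in> {1..f}" for k
    using that mu r P(4)[of "(m, u, k, r)"] by (simp_all add: sp)
  have "mutual_info (spir_space f \<Phi>) index_rv (\<lambda>w. restrict (query_rv \<Phi> w) B) = 0"
    using \<Phi>(2) B unfolding spir_user_secret_def by blast
  then obtain w where w: "w \<in> space (spir_space f \<Phi>)" "index_rv w = index_rv (m, u, k', r)"
      "restrict (query_rv \<Phi> w) B = restrict (query_rv \<Phi> (m, u, k, r)) B"
    by (rule mutual_info_eq_0_jointly_attained[OF P(1-3) _ pos[OF k(2)] pos[OF k(1)]])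
  obtain m'' u'' r' where w_eq: "w = (m'', u'', k', r')"
    using w(2) by (cases w) (auto simp: index_rv_def)
  show thesis
  proof
    show "r' \<in> user_set \<Phi>"
      using w(1) by (auto simp: w_eq sp)
    show "query_map \<Phi> k' r' j = query_map \<Phi> k r j" if "j \<in> B" for j
      using fun_cong[OF w(3), of j] that by (simp add: w_eq query_rv_def)
  qed
qed

section \<open>Criteria for correctness and secrecy of an NSS protocol\<close>

lemma nss_correctI:
  assumes \<Psi>: "nss_protocol n \<Psi>"
    and determined: "\<And>l l' u u'. l \<in> secret_set \<Psi> \<Longrightarrow> l' \<in> secret_set \<Psi> \<Longrightarrow>
      u \<in> dealer_set \<Psi> \<Longrightarrow> u' \<in> dealer_set \<Psi> \<Longrightarrow>
      (\<And>j. j \<in> A \<Longrightarrow> share_map \<Psi> l u j = share_map \<Psi> l' u' j) \<Longrightarrow> l = l'"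
  shows "ml_error (nss_space \<Psi>) (secret_set \<Psi>) fst (\<lambda>w. restrict (shares_rv \<Psi> w) A) = 0"
proof -
  have \<Omega>: "finite (secret_set \<Psi> \<times> dealer_set \<Psi>)" "secret_set \<Psi> \<times> dealer_set \<Psi> \<noteq> {}"
    using \<Psi> unfolding nss_protocol_def by auto
  note P = uniform_count_measure_facts[OF \<Omega>, folded nss_space_def]
  have sp: "space (nss_space \<Psi>) = secret_set \<Psi> \<times> dealer_set \<Psi>"
    by (simp add: nss_space_def space_uniform_count_measure)
  show ?thesis
  proof (rule ml_error_eq_0I[OF prob_space.finite_measure[OF P(1)] P(3)])
    fix w w' assume w: "w \<in> space (nss_space \<Psi>)" "w' \<in> space (nss_space \<Psi>)"
      and eq: "restrict (shares_rv \<Psi> w) A = restrict (shares_rv \<Psi> w') A"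
    have "shares_rv \<Psi> w j = shares_rv \<Psi> w' j" if "j \<in> A" for j
      using fun_cong[OF eq, of j] that by simp
    then show "fst w = fst w'"
      using w determined[of "fst w" "fst w'" "snd w" "snd w'"]
      by (auto simp: sp shares_rv_def)
  qed (use P sp in auto)
qed

text \<open>A permutation \<open>\<beta>\<close> of the dealer's randomness preserves the uniform
  distribution. It may depend on the secret, but \<open>c\<close> does not, so for every secret the
  shares of \<open>B\<close> are distributed like \<open>c t\<close> with uniform
  \<open>t\<close>.\<close>

lemma nss_secretI:
  fixes \<Psi> :: "('m, 'u, 's) nss"
  assumes \<Psi>: "nss_protocol n \<Psi>"
    and same: "\<And>l. l \<in> secret_set \<Psi> \<Longrightarrow> \<exists>\<beta>. bij_betw \<beta> (dealer_set \<Psi>) (dealer_set \<Psi>) \<and>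
      (\<forall>t\<in>dealer_set \<Psi>. \<forall>j\<in>B. share_map \<Psi> l (\<beta> t) j = c t j)"
  shows "mutual_info (nss_space \<Psi>) fst (\<lambda>w. restrict (shares_rv \<Psi> w) B) = 0"
proof -
  let ?L = "secret_set \<Psi>" and ?U = "dealer_set \<Psi>" and ?P = "nss_space \<Psi>"
  let ?S = "\<lambda>w. restrict (shares_rv \<Psi> w) B"
  have fin: "finite ?L" "finite ?U" "?L \<noteq> {}" "?U \<noteq> {}"
    using \<Psi> unfolding nss_protocol_def by auto
  then have \<Omega>: "finite (?L \<times> ?U)" "?L \<times> ?U \<noteq> {}"
    by auto
  note P = uniform_count_measure_facts[OF \<Omega>, folded nss_space_def]
  have sp: "space ?P = ?L \<times> ?U"
    by (simp add: nss_space_def space_uniform_count_measure)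
  have prob: "measure ?P A = card A / (card ?L * card ?U)" if "A \<subseteq> ?L \<times> ?U" for A
    unfolding nss_space_def using \<Omega> that
    by (simp add: measure_uniform_count_measure card_cartesian_product)
  define N where "N = (\<lambda>s. card {t \<in> ?U. restrict (c t) B = s})"
  \<comment> \<open>\<open>\<beta>\<close> carries the fibre of \<open>c\<close> over
    \<open>s\<close> bijectively onto the fibre of the shares, whose size is thus independent of
    \<open>l\<close>.\<close>
  have fibre: "card {u \<in> ?U. restrict (share_map \<Psi> l u) B = s} = N s" if l: "l \<in> ?L" for l s
  proof -
    obtain \<beta> where \<beta>: "bij_betw \<beta> ?U ?U" "\<forall>t\<in>?U. \<forall>j\<in>B. share_map \<Psi> l (\<beta> t) j = c t j"
      using same[OF l] by blast
    have eq: "restrict (share_map \<Psi> l (\<beta> t)) B = restrict (c t) B" if "t \<in> ?U" for t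
      using \<beta>(2) that by (intro restrict_ext) auto
    have "{u \<in> \<beta> ` ?U. restrict (share_map \<Psi> l u) B = s} =
        \<beta> ` {t \<in> ?U. restrict (share_map \<Psi> l (\<beta> t)) B = s}"
      by blast
    also have "{t \<in> ?U. restrict (share_map \<Psi> l (\<beta> t)) B = s} = {t \<in> ?U. restrict (c t) B = s}"
      using eq by auto
    finally have "{u \<in> ?U. restrict (share_map \<Psi> l u) B = s} = \<beta> ` {t \<in> ?U. restrict (c t) B = s}"
      unfolding bij_betw_imp_surj_on[OF \<beta>(1)] .
    moreover have "inj_on \<beta> {t \<in> ?U. restrict (c t) B = s}"
      using \<beta>(1) unfolding bij_betw_def by (auto intro: inj_on_subset)
    ultimately show ?thesis
      unfolding N_def by (simp add: card_image)
  qed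
  show ?thesis
  proof (rule mutual_info_eq_0I[OF P(1-3)])
    fix v assume v: "v \<in> space ?P"
    define l where "l = fst v"
    define s where "s = ?S v"
    have l: "l \<in> ?L"
      using v by (auto simp: l_def sp)
    have "{w \<in> space ?P. fst w = l \<and> ?S w = s} =
        {l} \<times> {u \<in> ?U. restrict (share_map \<Psi> l u) B = s}"
      using l by (auto simp: sp shares_rv_def)
    then have 1: "card {w \<in> space ?P. fst w = l \<and> ?S w = s} = N s"
      using fibre[OF l] by (simp add: card_cartesian_product)
    have "{w \<in> space ?P. fst w = l} = {l} \<times> ?U"
      using l by (auto simp: sp)
    then have 2: "card {w \<in> space ?P. fst w = l} = card ?U"
      by (simp add: card_cartesian_product)
    have "{w \<in> space ?P. ?S w = s} = (SIGMA l:?L. {u \<in> ?U. restrict (share_map \<Psi> l u) B = s})"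
      by (auto simp: sp shares_rv_def)
    then have 3: "card {w \<in> space ?P. ?S w = s} = card ?L * N s"
      using fin fibre by (simp add: card_SigmaI)
    have "card ?L > 0" "card ?U > 0"
      using fin by (auto simp: card_gt_0_iff)
    \<comment> \<open>With \<open>a = card ?L\<close> and \<open>b = card ?U\<close> this is the
      identity \<open>N s / (a * b) = (b / (a * b)) * (a * N s / (a * b))\<close>.\<close>
    then have "measure ?P {w \<in> space ?P. fst w = l \<and> ?S w = s} =
        measure ?P {w \<in> space ?P. fst w = l} * measure ?P {w \<in> space ?P. ?S w = s}"
      by (subst (1 2 3) prob) (auto simp: sp 1[unfolded sp] 2[unfolded sp] 3[unfolded sp] field_simps)
    then show "measure ?P {w \<in> space ?P. fst w = fst v \<and> ?S w = ?S v} =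
        measure ?P {w \<in> space ?P. fst w = fst v} * measure ?P {w \<in> space ?P. ?S w = ?S v}"
      unfolding l_def s_def .
  qed
qed

section \<open>Row submatrices, subvectors and concatenated files\<close>

lemma row_submatrix_carrier:
  assumes "A \<in> carrier_mat z c"
  shows "row_submatrix A (positions z \<tau> j) \<in> carrier_mat (card (positions z \<tau> j)) c"
proof -
  have "{i. i < z \<and> i \<in> positions z \<tau> j} = positions z \<tau> j"
    by (auto simp: positions_def)
  then show ?thesis
    unfolding row_submatrix_def dim_submatrix carrier_mat_def mem_Collect_eq
      carrier_matD[OF assms] by simp
qed

lemma pick_positions_less:
  assumes "i < card (positions z \<tau> j)"
  shows "pick (positions z \<tau> j) i < z"
proof (rule pick_le)
  have "{a. a < z \<and> a \<in> positions z \<tau> j} = positions z \<tau> j"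
    by (auto simp: positions_def)
  then show "i < card {a. a < z \<and> a \<in> positions z \<tau> j}"
    using assms by simp
qed

text \<open>Needed to turn answers computed server by server into parts of one vector of length
  \<open>z\<close>, the form that \<open>linear_nss\<close> demands.\<close>

lemma row_submatrix_mult_vec:
  assumes "A \<in> carrier_mat z c"
  shows "row_submatrix A (positions z \<tau> j) *\<^sub>v v = subvector (A *\<^sub>v v) (positions z \<tau> j)"
proof (rule eq_vecI)
  note dim = row_submatrix_carrier[OF assms, of \<tau> j]
  show "dim_vec (row_submatrix A (positions z \<tau> j) *\<^sub>v v) =
      dim_vec (subvector (A *\<^sub>v v) (positions z \<tau> j))"
    using dim by (simp add: subvector_def)
  fix i assume "i < dim_vec (subvector (A *\<^sub>v v) (positions z \<tau> j))"
  then have i: "i < card (positions z \<tau> j)"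
    by (simp add: subvector_def)
  have "row (row_submatrix A (positions z \<tau> j)) i = row A (pick (positions z \<tau> j) i)"
  proof (rule eq_vecI)
    fix b assume "b < dim_vec (row A (pick (positions z \<tau> j) i))"
    then have b: "b < c"
      using assms by simp
    have "row_submatrix A (positions z \<tau> j) $$ (i, b) =
        A $$ (pick (positions z \<tau> j) i, pick UNIV b)"
      using i b dim unfolding row_submatrix_def
      by (intro submatrix_index) (metis carrier_matD dim_submatrix)+
    then show "row (row_submatrix A (positions z \<tau> j)) i $ b = row A (pick (positions z \<tau> j) i) $ b"
      using i b carrier_matD[OF dim] carrier_matD[OF assms] pick_positions_less[OF i]
      by (simp add: pick_UNIV)
  qed (use assms dim in auto)
  then show "(row_submatrix A (positions z \<tau> j) *\<^sub>v v) $ i =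
      subvector (A *\<^sub>v v) (positions z \<tau> j) $ i"
    using i dim assms pick_positions_less[OF i] by (simp add: subvector_def)
qed

lemma subvector_add:
  assumes "v \<in> carrier_vec z" "w \<in> carrier_vec z"
  shows "subvector (v + w) (positions z \<tau> j) =
    subvector v (positions z \<tau> j) + subvector w (positions z \<tau> j)"
  using assms pick_positions_less by (intro eq_vecI) (auto simp: subvector_def)

text \<open>Restricted to \<open>{1..f}\<close> because \<open>file_tuples\<close> consists of
  extensional functions. For \<open>i = 1\<close> this is the file tuple used in
  \<open>nss_of_spir\<close>.\<close>

definition single_file :: "nat \<Rightarrow> nat \<Rightarrow> nat \<Rightarrow> 'a::zero fvec \<Rightarrow> nat \<Rightarrow> 'a fvec" where
  "single_file f x i v = (\<lambda>i'\<in>{1..f}. if i' = i then v else 0\<^sub>v x)"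

lemma single_file_in_file_tuples:
  assumes "file_set \<Phi> = carrier_vec x" "v \<in> carrier_vec x"
  shows "single_file f x i v \<in> file_tuples f \<Phi>"
  using assms unfolding single_file_def file_tuples_def by auto

lemma concat_files_carrier: "concat_files f x m \<in> carrier_vec (f * x)"
  unfolding concat_files_def by simp

text \<open>Appending \<open>f * x\<close> zeros and cutting back to length \<open>f * x\<close>
  expresses \<open>(v, 0, ..., 0)\<close> without the length \<open>(f - 1) * x\<close> and without
  an assumption on \<open>f\<close>.\<close>

lemma concat_files_single_first:
  assumes "v \<in> carrier_vec x"
  shows "concat_files f x (single_file f x 1 v) = vec_first (v @\<^sub>v 0\<^sub>v (f * x)) (f * x)"
proof (rule eq_vecI)
  fix i assume "i < dim_vec (vec_first (v @\<^sub>v 0\<^sub>v (f * x)) (f * x))"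
  then have i: "i < f * x"
    by simp
  then have "i div x < f" "x > 0"
    by (auto simp: less_mult_imp_div_less intro: gr0I)
  \<comment> \<open>Entry \<open>i\<close> is read from file \<open>i div x + 1\<close>, so file 1
    fills exactly the entries below \<open>x\<close>.\<close>
  then have "i div x = 0 \<longleftrightarrow> i < x" "i mod x < x"
    by (auto simp: div_eq_0_iff)
  then show "concat_files f x (single_file f x 1 v) $ i =
      vec_first (v @\<^sub>v 0\<^sub>v (f * x)) (f * x) $ i"
    using i assms \<open>i div x < f\<close> unfolding concat_files_def single_file_def vec_first_def
    by (cases "i < x") auto
qed (simp add: concat_files_def)

lemma concat_files_single_zero: "concat_files f x (single_file f x i (0\<^sub>v x)) = 0\<^sub>v (f * x)"
proof (rule eq_vecI)
  fix b assume "b < dim_vec (0\<^sub>v (f * x) :: 'a fvec)"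
  then have b: "b < f * x"
    by simp
  then have "b div x < f" "x > 0"
    by (auto simp: less_mult_imp_div_less intro: gr0I)
  then show "concat_files f x (single_file f x i (0\<^sub>v x)) $ b = (0\<^sub>v (f * x) :: 'a fvec) $ b"
    using b unfolding concat_files_def single_file_def by simp
qed (simp add: concat_files_def)

section \<open>The matrices of a linear SPIR protocol and the masking of non-requested files\<close>

locale linear_spir_matrices =
  fixes n f x y z :: nat and \<tau> :: "nat \<Rightarrow> nat"
    and \<Phi> :: "('a::{field, finite} fvec, 'a fvec, 'r, 'a fvec, 'a fmat, 'a fvec) spir"
    and H :: "'a fmat" and Q :: "nat \<Rightarrow> 'r \<Rightarrow> 'a fmat"
  assumes linear: "linear_spir n f x y z \<tau> \<Phi>"
    and H_carrier: "H \<in> carrier_mat z y"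
    and Q_carrier: "k \<in> {1..f} \<Longrightarrow> r \<in> user_set \<Phi> \<Longrightarrow> Q k r \<in> carrier_mat z (f * x)"
    and query_eq: "k \<in> {1..f} \<Longrightarrow> r \<in> user_set \<Phi> \<Longrightarrow> j \<in> {1..n} \<Longrightarrow>
      query_map \<Phi> k r j = row_submatrix (Q k r) (positions z \<tau> j)"
    and answer_eq: "k \<in> {1..f} \<Longrightarrow> r \<in> user_set \<Phi> \<Longrightarrow> j \<in> {1..n} \<Longrightarrow>
      m \<in> file_tuples f \<Phi> \<Longrightarrow> u \<in> carrier_vec y \<Longrightarrow>
      answer_rv \<Phi> (m, u, k, r) j =
        query_map \<Phi> k r j *\<^sub>v concat_files f x m + row_submatrix H (positions z \<tau> j) *\<^sub>v u"
begin

lemma protocol: "spir_protocol n f \<Phi>"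
  and file_set_eq: "file_set \<Phi> = carrier_vec x"
  and seed_set_eq: "seed_set \<Phi> = carrier_vec y"
  using linear unfolding linear_spir_def by blast+

end

text \<open>The witnesses are chosen once, so that all later lemmas share \<open>H\<close> and
  \<open>Q\<close>. The answer formula in \<open>linear_spir\<close> presupposes that queries and
  shared randomness lie in their sets, which is settled here too.\<close>

lemma linear_spir_matrices_exist:
  fixes \<Phi> :: "('a::{field, finite} fvec, 'a fvec, 'r, 'a fvec, 'a fmat, 'a fvec) spir"
  assumes "linear_spir n f x y z \<tau> \<Phi>"
  obtains H Q where "linear_spir_matrices n f x y z \<tau> \<Phi> H Q"
proof -
  have \<Phi>: "spir_protocol n f \<Phi>" "seed_set \<Phi> = carrier_vec y"
    "\<forall>j\<in>{1..n}. \<forall>q\<in>query_set \<Phi> j. \<forall>m\<in>file_tuples f \<Phi>. \<forall>t\<in>srand_set \<Phi> j.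
        answer_map \<Phi> j q m t = q *\<^sub>v concat_files f x m + t"
    using assms unfolding linear_spir_def by blast+
  obtain H where H: "H \<in> carrier_mat z y" "\<forall>u \<in> carrier_vec y. \<forall>j\<in>{1..n}.
      srand_map \<Phi> u j = row_submatrix H (positions z \<tau> j) *\<^sub>v u"
    using assms unfolding linear_spir_def by blast
  obtain Q where Q: "\<forall>k\<in>{1..f}. \<forall>r\<in>user_set \<Phi>. Q k r \<in> carrier_mat z (f * x) \<and>
      (\<forall>j\<in>{1..n}. query_map \<Phi> k r j = row_submatrix (Q k r) (positions z \<tau> j))"
    using assms unfolding linear_spir_def by blast
  show thesis
  proof (rule that[of H Q], unfold_locales)
    fix k r j m and u :: "'a fvec"
    assume *: "k \<in> {1..f}" "r \<in> user_set \<Phi>" "j \<in> {1..n}" "m \<in> file_tuples f \<Phi>"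
      and u: "u \<in> carrier_vec y"
    then have "query_map \<Phi> k r j \<in> query_set \<Phi> j" "srand_map \<Phi> u j \<in> srand_set \<Phi> j"
      using \<Phi>(1,2) unfolding spir_protocol_def by blast+
    then show "answer_rv \<Phi> (m, u, k, r) j =
        query_map \<Phi> k r j *\<^sub>v concat_files f x m + row_submatrix H (positions z \<tau> j) *\<^sub>v u"
      using * \<Phi>(3) H(2) u unfolding answer_rv_def by simp
  qed (use assms H Q in auto)
qed

text \<open>With only file \<open>i\<close> nonzero, an answer is the contribution of that file plus
  a part of \<open>H u\<close>; one seed \<open>u\<close> cancels the contribution at all servers at
  once. The set \<open>A\<close> serves to pin down the requested file.\<close>

lemma (in linear_spir_matrices) other_file_masked:
  assumes correct: "spir_correct AA f \<Phi>" and secret: "spir_server_secret n f \<Phi>"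
    and A: "A \<in> AA" "A \<subseteq> {1..n}"
    and kr: "k \<in> {1..f}" "r \<in> user_set \<Phi>"
    and i: "i \<noteq> k" and v: "v \<in> carrier_vec x"
  obtains u where "u \<in> carrier_vec y"
    "\<And>j. j \<in> {1..n} \<Longrightarrow>
      answer_rv \<Phi> (single_file f x i v, u, k, r) j = 0\<^sub>v (card (positions z \<tau> j))"
proof -
  note ft = single_file_in_file_tuples[OF file_set_eq, where f=f and i=i]
  let ?o = "single_file f x i (0\<^sub>v x) :: nat \<Rightarrow> 'a fvec"
  have mult_zero: "M *\<^sub>v 0\<^sub>v c = 0\<^sub>v s" if "M \<in> carrier_mat s c" for M :: "'a fmat" and s c
    using that by (intro eq_vecI) auto
  \<comment> \<open>The reference outcome: zero files and zero seed give zero answers.\<close>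
  have zero: "answer_rv \<Phi> (?o, 0\<^sub>v y, k, r) j = 0\<^sub>v (card (positions z \<tau> j))" if "j \<in> {1..n}" for j
    using query_eq[OF kr that] answer_eq[OF kr that ft[OF zero_carrier_vec] zero_carrier_vec]
      mult_zero[OF row_submatrix_carrier[OF H_carrier]]
      mult_zero[OF row_submatrix_carrier[OF Q_carrier[OF kr]]]
    by (simp add: concat_files_single_zero)
  have zero_seed: "0\<^sub>v y \<in> seed_set \<Phi>"
    using seed_set_eq by simp
  obtain m u where mu: "m \<in> file_tuples f \<Phi>" "u \<in> seed_set \<Phi>"
    "\<And>j. j \<in> {1..n} \<Longrightarrow> answer_rv \<Phi> (m, u, k, r) j = answer_rv \<Phi> (?o, 0\<^sub>v y, k, r) j"
    "\<And>i'. i' \<in> {1..f} - {k} \<Longrightarrow> m i' = single_file f x i v i'"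
    by (rule spir_server_secretD[OF protocol secret kr ft[OF zero_carrier_vec] ft[OF v] zero_seed],
        rule that)
  \<comment> \<open>\<open>(m, u)\<close> and the reference outcome have equal answers, so
    correctness equates their requested files.\<close>
  have "m k = ?o k"
    using mu(3) A(2) by (intro spir_correctD[OF protocol correct kr A(1) mu(1)
      ft[OF zero_carrier_vec] mu(2) zero_seed]) blast
  \<comment> \<open>At \<open>k\<close> both sides are the zero vector, as
    \<open>i \<noteq> k\<close>; outside \<open>{1..f}\<close> both are
    \<open>undefined\<close>.\<close>
  then have "m i' = single_file f x i v i'" for i'
    using mu(1,4) kr i by (cases "i' = k"; cases "i' \<in> {1..f}")
      (auto simp: single_file_def file_tuples_def PiE_def extensional_def)
  then have "m = single_file f x i v"
    by (rule ext)
  then show thesis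
    using that[of u] mu zero seed_set_eq by simp
qed

text \<open>This is the shape of \<open>\<psi>\<close> for the NSS protocol:
  \<open>vec_first\<close> and \<open>vec_last\<close> recover secret and dealer's randomness from
  their concatenation, and the padded secret is the concatenated file vector.\<close>

lemma linear_map_mult_first_last:
  fixes M H :: "'a::field mat"
  assumes M: "M \<in> carrier_mat z c" and H: "H \<in> carrier_mat z y"
  shows "linear_map class_ring (module_vec TYPE('a) (x + y)) (module_vec TYPE('a) z)
    (\<lambda>v. M *\<^sub>v vec_first (vec_first v x @\<^sub>v 0\<^sub>v c) c + H *\<^sub>v vec_last v y)"
proof -
  let ?first = "\<lambda>v :: 'a fvec. vec_first (vec_first v x @\<^sub>v 0\<^sub>v c) c"
  have add: "?first (v + w) = ?first v + ?first w" "vec_last (v + w) y = vec_last v y + vec_last w y"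
    if "v \<in> carrier_vec (x + y)" "w \<in> carrier_vec (x + y)" for v w
    using that by (auto intro!: eq_vecI simp: vec_first_def vec_last_def)
  have smult: "?first (a \<cdot>\<^sub>v v) = a \<cdot>\<^sub>v ?first v" "vec_last (a \<cdot>\<^sub>v v) y = a \<cdot>\<^sub>v vec_last v y"
    if "v \<in> carrier_vec (x + y)" for a v
    using that by (auto intro!: eq_vecI simp: vec_first_def vec_last_def)
  note carrier = mult_mat_vec_carrier[OF M vec_first_carrier]
    mult_mat_vec_carrier[OF H vec_last_carrier]
  show ?thesis
    unfolding linear_map_def mod_hom_def mod_hom_axioms_def module_hom_def module_vec_simps
  proof (intro conjI vec_vs vec_module CollectI allI impI)
    show "(\<lambda>v. M *\<^sub>v ?first v + H *\<^sub>v vec_last v y) \<in> carrier_vec (x + y) \<rightarrow> carrier_vec z"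
      using carrier by (intro funcsetI add_carrier_vec)
  next
    fix v w :: "'a fvec" assume vw: "v \<in> carrier_vec (x + y) \<and> w \<in> carrier_vec (x + y)"
    have "M *\<^sub>v ?first (v + w) + H *\<^sub>v vec_last (v + w) y =
        (M *\<^sub>v ?first v + M *\<^sub>v ?first w) + (H *\<^sub>v vec_last v y + H *\<^sub>v vec_last w y)"
      using vw add mult_add_distrib_mat_vec[OF M vec_first_carrier vec_first_carrier]
        mult_add_distrib_mat_vec[OF H vec_last_carrier vec_last_carrier] by simp
    also have "\<dots> = (M *\<^sub>v ?first v + H *\<^sub>v vec_last v y) + (M *\<^sub>v ?first w + H *\<^sub>v vec_last w y)"
      using M H by (intro eq_vecI) auto
    finally show "M *\<^sub>v ?first (v + w) + H *\<^sub>v vec_last (v + w) y =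
      (M *\<^sub>v ?first v + H *\<^sub>v vec_last v y) + (M *\<^sub>v ?first w + H *\<^sub>v vec_last w y)" .
  next
    fix a :: 'a and v :: "'a fvec" assume av: "a \<in> carrier class_ring \<and> v \<in> carrier_vec (x + y)"
    then show "M *\<^sub>v ?first (a \<cdot>\<^sub>v v) + H *\<^sub>v vec_last (a \<cdot>\<^sub>v v) y =
        a \<cdot>\<^sub>v (M *\<^sub>v ?first v + H *\<^sub>v vec_last v y)"
      using smult mult_mat_vec[OF M vec_first_carrier] mult_mat_vec[OF H vec_last_carrier]
        smult_add_distrib_vec[OF carrier] by simp
  qed
qed

section \<open>The NSS protocol obtained from the SPIR protocol\<close>

lemma nss_of_spir_simps:
  "secret_set (nss_of_spir f x r \<Phi>) = file_set \<Phi>"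
  "dealer_set (nss_of_spir f x r \<Phi>) = seed_set \<Phi>"
  "share_set (nss_of_spir f x r \<Phi>) = answer_set \<Phi>"
  "share_map (nss_of_spir f x r \<Phi>) l u j = answer_rv \<Phi> (single_file f x 1 l, u, 1, r) j"
  unfolding nss_of_spir_def single_file_def by simp_all

lemma nss_protocol_nss_of_spir:
  assumes \<Phi>: "spir_protocol n f \<Phi>" "file_set \<Phi> = carrier_vec x"
    and "1 \<le> f" "r \<in> user_set \<Phi>"
  shows "nss_protocol n (nss_of_spir f x r \<Phi>)"
  using \<Phi>(1) assms(3,4) single_file_in_file_tuples[OF \<Phi>(2)]
  unfolding nss_protocol_def spir_protocol_def nss_of_spir_simps
  by (simp add: answer_rv_def \<Phi>(2))

lemma (in linear_spir_matrices) linear_nss_nss_of_spir: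
  assumes f: "1 \<le> f" and r: "r \<in> user_set \<Phi>"
  shows "linear_nss n x y z \<tau> (nss_of_spir f x r \<Phi>)"
proof -
  have lin: "\<tau> \<in> {..<z} \<rightarrow> {1..n}"
    "\<forall>j\<in>{1..n}. answer_set \<Phi> j = carrier_vec (card (positions z \<tau> j))"
    using linear unfolding linear_spir_def by blast+
  have one: "1 \<in> {1..f}"
    using f by simp
  note Q = Q_carrier[OF one r]
  \<comment> \<open>On \<open>l @\<^sub>v u\<close> the first summand is the query matrix for index
    1 applied to the files \<open>(l, 0, ..., 0)\<close>, the second is \<open>H\<close> applied to
    the seed \<open>u\<close>.\<close>
  define \<psi> where "\<psi> = (\<lambda>v. Q 1 r *\<^sub>v vec_first (vec_first v x @\<^sub>v 0\<^sub>v (f * x)) (f * x) + H *\<^sub>v vec_last v y)"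
  have "share_map (nss_of_spir f x r \<Phi>) l u j = subvector (\<psi> (l @\<^sub>v u)) (positions z \<tau> j)"
    if l: "l \<in> carrier_vec x" and u: "u \<in> carrier_vec y" and j: "j \<in> {1..n}" for l u j
  proof -
    have split: "vec_first (l @\<^sub>v u) x = l" "vec_last (l @\<^sub>v u) y = u"
      using l u by (auto intro!: eq_vecI simp: vec_first_def vec_last_def)
    show ?thesis
      unfolding nss_of_spir_simps \<psi>_def split
      using answer_eq[OF one r j single_file_in_file_tuples[OF file_set_eq l] u] query_eq[OF one r j]
        row_submatrix_mult_vec[OF Q] row_submatrix_mult_vec[OF H_carrier]
        subvector_add[OF mult_mat_vec_carrier[OF Q vec_first_carrier] mult_mat_vec_carrier[OF H_carrier u]]
        concat_files_single_first[OF l]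
      by simp
  qed
  moreover have "linear_map class_ring (module_vec TYPE('a) (x + y)) (module_vec TYPE('a) z) \<psi>"
    unfolding \<psi>_def by (rule linear_map_mult_first_last[OF Q H_carrier])
  ultimately show ?thesis
    unfolding linear_nss_def
    using nss_protocol_nss_of_spir[OF protocol file_set_eq f r] lin file_set_eq seed_set_eq
      nss_of_spir_simps(1-3)[of f x r \<Phi>] by auto
qed

text \<open>All shares arise from the same values \<open>K = 1\<close> and \<open>R = r\<close>, so
  SPIR correctness for these values recovers file 1, which is the secret.\<close>

lemma nss_of_spir_correct:
  fixes \<Phi> :: "('a::{field, finite} fvec, 'a fvec, 'r, 'a fvec, 'a fmat, 'a fvec) spir"
  assumes \<Phi>: "spir_protocol n f \<Phi>" "file_set \<Phi> = carrier_vec x" "spir_correct AA f \<Phi>"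
    and f: "1 \<le> f" and r: "r \<in> user_set \<Phi>" and A: "A \<in> AA"
  defines "\<Psi> \<equiv> nss_of_spir f x r \<Phi>"
  shows "ml_error (nss_space \<Psi>) (secret_set \<Psi>) fst (\<lambda>w. restrict (shares_rv \<Psi> w) A) = 0"
  unfolding \<Psi>_def
proof (rule nss_correctI[OF nss_protocol_nss_of_spir[OF \<Phi>(1,2) f r]], unfold nss_of_spir_simps)
  fix l l' u u'
  assume l: "l \<in> file_set \<Phi>" "l' \<in> file_set \<Phi>" and u: "u \<in> seed_set \<Phi>" "u' \<in> seed_set \<Phi>"
    and eq: "\<And>j. j \<in> A \<Longrightarrow> answer_rv \<Phi> (single_file f x 1 l, u, 1, r) j =
      answer_rv \<Phi> (single_file f x 1 l', u', 1, r) j"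
  have "1 \<in> {1..f}"
    using f by simp
  then have "single_file f x 1 l 1 = single_file f x 1 l' 1"
    using l \<Phi>(2)
    by (intro spir_correctD[OF \<Phi>(1,3) _ r A _ _ u eq] single_file_in_file_tuples) auto
  then show "l = l'"
    using f by (simp add: single_file_def)
qed

text \<open>Index 2 exists because \<open>f \<ge> 2\<close>, and under it file 1, which holds the
  secret, is not requested and can be masked. User secrecy carries the masking back to index 1 on
  \<open>B\<close>.\<close>

lemma (in linear_spir_matrices) nss_of_spir_secret:
  assumes sec: "csspir_protocol AA BB n f \<Phi>"
    and A: "A \<in> AA" "A \<subseteq> {1..n}" and B: "B \<in> BB" "B \<subseteq> {1..n}"
    and f: "2 \<le> f" and r: "r \<in> user_set \<Phi>"
  defines "\<Psi> \<equiv> nss_of_spir f x r \<Phi>"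
  shows "mutual_info (nss_space \<Psi>) fst (\<lambda>w. restrict (shares_rv \<Psi> w) B) = 0"
proof -
  have secure: "spir_correct AA f \<Phi>" "spir_server_secret n f \<Phi>" "spir_user_secret BB f \<Phi>"
    using sec unfolding csspir_protocol_def by blast+
  have k: "1 \<in> {1..f}" "2 \<in> {1..f}"
    using f by simp_all
  then have f1: "1 \<le> f"
    by simp
  obtain r' where r': "r' \<in> user_set \<Phi>" "\<And>j. j \<in> B \<Longrightarrow> query_map \<Phi> 2 r' j = query_map \<Phi> 1 r j"
    using spir_user_secretD[OF protocol secure(3) k r B(1)] by blast
  let ?H = "\<lambda>j. row_submatrix H (positions z \<tau> j)"
  show ?thesis
    unfolding \<Psi>_def
  \<comment> \<open>The common form of the shares on \<open>B\<close> is the pure shared randomness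
    of a seed \<open>t\<close>, free of the secret.\<close>
  proof (rule nss_secretI[where c = "\<lambda>t j. ?H j *\<^sub>v t",
        OF nss_protocol_nss_of_spir[OF protocol file_set_eq f1 r]], unfold nss_of_spir_simps file_set_eq seed_set_eq)
    fix l :: "'a fvec" assume l: "l \<in> carrier_vec x"
    note ft = single_file_in_file_tuples[OF file_set_eq l, where f=f and i=1]
    obtain u where u: "u \<in> carrier_vec y" "\<And>j. j \<in> {1..n} \<Longrightarrow>
        answer_rv \<Phi> (single_file f x 1 l, u, 2, r') j = 0\<^sub>v (card (positions z \<tau> j))"
      using other_file_masked[OF secure(1,2) A k(2) r'(1) _ l, of 1] by auto
    \<comment> \<open>The permutation is translation by the masking seed \<open>u\<close>, which
      depends on \<open>l\<close>.\<close>
    have "bij_betw ((+) u) (carrier_vec y) (carrier_vec y)"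
    proof (rule bij_betwI[where g = "\<lambda>t. t - u"])
      show "u + t - u = t" "u + (t - u) = t" if "t \<in> carrier_vec y" for t
        using u(1) that by (auto intro!: eq_vecI)
    qed (use u(1) in auto)
    moreover have "answer_rv \<Phi> (single_file f x 1 l, u + t, 1, r) j = ?H j *\<^sub>v t"
      if t: "t \<in> carrier_vec y" and j: "j \<in> B" for t j
    proof -
      have jn: "j \<in> {1..n}"
        using j B by blast
      let ?q = "query_map \<Phi> 1 r j *\<^sub>v concat_files f x (single_file f x 1 l)"
      note Hj = row_submatrix_carrier[OF H_carrier, of \<tau> j]
      have q: "?q \<in> carrier_vec (card (positions z \<tau> j))"
        unfolding query_eq[OF k(1) r jn]
        by (rule mult_mat_vec_carrier[OF row_submatrix_carrier[OF Q_carrier[OF k(1) r]] concat_files_carrier])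
      have "answer_rv \<Phi> (single_file f x 1 l, u + t, 1, r) j = ?q + (?H j *\<^sub>v u + ?H j *\<^sub>v t)"
        using answer_eq[OF k(1) r jn ft] u(1) t mult_add_distrib_mat_vec[OF Hj u(1) t] by simp
      also have "\<dots> = (?q + ?H j *\<^sub>v u) + ?H j *\<^sub>v t"
        using assoc_add_vec[OF q mult_mat_vec_carrier[OF Hj u(1)] mult_mat_vec_carrier[OF Hj t]] by simp
      \<comment> \<open>The masking holds for index 2 and randomness \<open>r'\<close>; server
        \<open>j\<close> in \<open>B\<close> gets the same query for index 1 and randomness
        \<open>r\<close>, and its answer depends on index and randomness only through the
        query.\<close>
      also have "?q + ?H j *\<^sub>v u = 0\<^sub>v (card (positions z \<tau> j))"
        using answer_eq[OF k(2) r'(1) jn ft u(1)] u(2)[OF jn] r'(2)[OF j] by simp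
      also have "\<dots> + ?H j *\<^sub>v t = ?H j *\<^sub>v t"
        using mult_mat_vec_carrier[OF Hj t] by simp
      finally show ?thesis .
    qed
    ultimately show "\<exists>\<beta>. bij_betw \<beta> (carrier_vec y) (carrier_vec y) \<and>
        (\<forall>t\<in>carrier_vec y. \<forall>j\<in>B.
          answer_rv \<Phi> (single_file f x 1 l, \<beta> t, 1, r) j = ?H j *\<^sub>v t)"
      by blast
  qed
qed

theorem corollary1:
  fixes n f x y z :: nat
    and AA BB :: "nat set set"
    and \<tau> :: "nat \<Rightarrow> nat"
    and \<Phi> :: "('a::{field, finite} fvec, 'a fvec, 'r, 'a fvec, 'a fmat, 'a fvec) spir"
    and r0 :: 'r
    and R_PIR \<rho> :: real
  assumes "n \<ge> 1" and "f \<ge> 2"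
    and "access_structure n AA BB" and "AA \<noteq> {}"
    and "linear_spir n f x y z \<tau> \<Phi>"
    and "csspir_protocol AA BB n f \<Phi>"
    and "pir_rate n \<Phi> = R_PIR"
    and "shared_randomness_rate \<Phi> = \<rho>"
    and "r0 \<in> user_set \<Phi>"
  shows "linear_nss n x y z \<tau> (nss_of_spir f x r0 \<Phi>) \<and>
         csnss_protocol AA BB n (nss_of_spir f x r0 \<Phi>) \<and>
         ss_rate n (nss_of_spir f x r0 \<Phi>) = R_PIR \<and>
         nss_randomness_rate (nss_of_spir f x r0 \<Phi>) = \<rho>"
proof (intro conjI)
  have f: "1 \<le> f"
    using assms(2) by simp
  have "AA \<subseteq> Pow {1..n}" "BB \<subseteq> Pow {1..n}"
    using assms(3) by (simp_all add: access_structure_def)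
  \<comment> \<open>A single authorised set is enough for the masking argument, and the same
    \<open>A\<close> serves every \<open>B\<close> in \<open>BB\<close>.\<close>
  with assms(4) obtain A where A: "A \<in> AA" "A \<subseteq> {1..n}"
    and BB: "\<And>B. B \<in> BB \<Longrightarrow> B \<subseteq> {1..n}"
    by blast
  have correct: "spir_correct AA f \<Phi>"
    using assms(6) unfolding csspir_protocol_def by blast
  obtain H Q where "linear_spir_matrices n f x y z \<tau> \<Phi> H Q"
    by (rule linear_spir_matrices_exist[OF assms(5)])
  then interpret linear_spir_matrices n f x y z \<tau> \<Phi> H Q .
  show "linear_nss n x y z \<tau> (nss_of_spir f x r0 \<Phi>)"
    by (rule linear_nss_nss_of_spir[OF f assms(9)])
  show "csnss_protocol AA BB n (nss_of_spir f x r0 \<Phi>)"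
    unfolding csnss_protocol_def
    by (intro conjI ballI nss_protocol_nss_of_spir[OF protocol file_set_eq f assms(9)]
        nss_of_spir_correct[OF protocol file_set_eq correct f assms(9)]
        nss_of_spir_secret[OF assms(6) A _ BB assms(2,9)])
  \<comment> \<open>Files, seeds and answers are taken over as secrets, dealer's randomness and
    shares, so both rates are the same quotients as for \<open>\<Phi>\<close>.\<close>
  show "ss_rate n (nss_of_spir f x r0 \<Phi>) = R_PIR"
    using assms(7) unfolding ss_rate_def pir_rate_def nss_of_spir_simps .
  show "nss_randomness_rate (nss_of_spir f x r0 \<Phi>) = \<rho>"
    using assms(8) unfolding nss_randomness_rate_def shared_randomness_rate_def nss_of_spir_simps .
qed

end
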